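(* Let $G$ be a finite, simple, connected graph with at least one edge and with $\zeta(G)>0$. Then $G$ is stable in respect of chromatic completion ($SCC$) if and only if the chromatic completion edge set $E_\chi(G)$ is unique.
   Context: A chromatic colouring of a graph $G$ is a proper vertex colouring $\varphi$ of $G$ with exactly $\chi(G)$ colours. For a chromatic colouring $\varphi$, let $E_\varphi(G)$ be the set of all pairs $uv$ of distinct non-adjacent vertices of $G$ with $\varphi(u)\neq\varphi(v)$ (the edges that can be added to $G$ without creating an edge whose ends have the same colour). The chromatic completion number is $\zeta(G)=\max_\varphi |E_\varphi(G)|$, the maximum taken over all chromatic colourings $\varphi$ of $G$. A Lucky colouring of $G$ is a chromatic colouring $\varphi$ whose colour classes yield the maximum number of chromatic completion edges, i.e. $|E_\varphi(G)|=\zeta(G)$. (In particular, if $G$ has a chromatic colouring whose colour-class sizes pairwise differ by at most $1$, the Lucky colourings are exactly those chromatic colourings.) For a Lucky colouring $\varphi$, the set $E_\varphi(G)$ is called a chromatic completion edge set and is denoted $E_\chi(G)$; $E_\chi(G)$ is unique if all Lucky colourings of $G$ yield the same set. The graph $G$ is stable in respect of chromatic completion ($SCC$) if all Lucky colourings of $G$ yield the same partition of $V(G)$ into colour classes (so they differ only by interchanging colours). *)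

theory Defs
  imports "Graph_Theory.Digraph_Component"
begin

text \<open>
  A finite simple graph is a \<open>pair_graph\<close>: a finite, loop-free, symmetric digraph whose arcs are
  ordered pairs of vertices. The undirected edge \<open>uv\<close> is thus represented by the two arcs
  \<open>(u, v)\<close> and \<open>(v, u)\<close>.

  Colours are natural numbers. Only the values of a colouring on the vertex set matter, and the
  number of colours it uses is the cardinality of its image of the vertex set.
\<close>

definition proper_colouring :: "'a pair_pre_digraph \<Rightarrow> ('a \<Rightarrow> nat) \<Rightarrow> bool" where
  "proper_colouring G \<phi> \<longleftrightarrow> (\<forall>(u, v) \<in> parcs G. \<phi> u \<noteq> \<phi> v)"

definition chromatic_number :: "'a pair_pre_digraph \<Rightarrow> nat" where
  "chromatic_number G = (LEAST k. \<exists>\<phi>. proper_colouring G \<phi> \<and> card (\<phi> ` pverts G) = k)"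

definition chromatic_colouring :: "'a pair_pre_digraph \<Rightarrow> ('a \<Rightarrow> nat) \<Rightarrow> bool" where
  "chromatic_colouring G \<phi> \<longleftrightarrow>
     proper_colouring G \<phi> \<and> card (\<phi> ` pverts G) = chromatic_number G"

text \<open>Completion edges are unordered pairs, so that each is counted once.\<close>

definition completion_edges :: "'a pair_pre_digraph \<Rightarrow> ('a \<Rightarrow> nat) \<Rightarrow> 'a set set" where
  "completion_edges G \<phi> =
     {{u, v} | u v. u \<in> pverts G \<and> v \<in> pverts G \<and> u \<noteq> v \<and> (u, v) \<notin> parcs G \<and> \<phi> u \<noteq> \<phi> v}"

definition chromatic_completion_number :: "'a pair_pre_digraph \<Rightarrow> nat" where
  "chromatic_completion_number G =
     Max {card (completion_edges G \<phi>) | \<phi>. chromatic_colouring G \<phi>}"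

definition lucky_colouring :: "'a pair_pre_digraph \<Rightarrow> ('a \<Rightarrow> nat) \<Rightarrow> bool" where
  "lucky_colouring G \<phi> \<longleftrightarrow>
     chromatic_colouring G \<phi> \<and> card (completion_edges G \<phi>) = chromatic_completion_number G"

definition colour_classes :: "'a pair_pre_digraph \<Rightarrow> ('a \<Rightarrow> nat) \<Rightarrow> 'a set set" where
  "colour_classes G \<phi> = {{v \<in> pverts G. \<phi> v = c} | c. c \<in> \<phi> ` pverts G}"

definition SCC :: "'a pair_pre_digraph \<Rightarrow> bool" where
  "SCC G \<longleftrightarrow> (\<forall>\<phi> \<psi>. lucky_colouring G \<phi> \<longrightarrow> lucky_colouring G \<psi> \<longrightarrow>
     colour_classes G \<phi> = colour_classes G \<psi>)"

definition unique_chromatic_completion_edge_set :: "'a pair_pre_digraph \<Rightarrow> bool" where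
  "unique_chromatic_completion_edge_set G \<longleftrightarrow>
     (\<forall>\<phi> \<psi>. lucky_colouring G \<phi> \<longrightarrow> lucky_colouring G \<psi> \<longrightarrow>
        completion_edges G \<phi> = completion_edges G \<psi>)"

text \<open>For finite simple graphs the \<open>LEAST\<close> and the \<open>Max\<close> above are attained.\<close>

lemma ex_chromatic_colouring:
  assumes "pair_graph G"
  shows "\<exists>\<phi>. chromatic_colouring G \<phi>"
proof -
  interpret pair_graph G by fact
  obtain f :: "'a \<Rightarrow> nat" where f: "inj_on f (pverts G)"
    using finite_imp_inj_to_nat_seg[OF pair_finite_verts] by metis
  have "f u \<noteq> f v" if "(u, v) \<in> parcs G" for u v
  proof -
    have "u \<in> pverts G" "v \<in> pverts G" "u \<noteq> v"
      using arc_fst_in_verts[OF that] arc_snd_in_verts[OF that] pair_no_loops[OF that] by simp_all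
    then show ?thesis
      using f by (simp add: inj_on_eq_iff)
  qed
  then have "proper_colouring G f"
    unfolding proper_colouring_def by blast
  then have "\<exists>k \<phi>. proper_colouring G \<phi> \<and> card (\<phi> ` pverts G) = k"
    by blast
  then have "\<exists>\<phi>. proper_colouring G \<phi> \<and> card (\<phi> ` pverts G) = chromatic_number G"
    unfolding chromatic_number_def by (rule LeastI_ex)
  then show ?thesis
    unfolding chromatic_colouring_def .
qed

lemma ex_lucky_colouring:
  assumes "pair_graph G"
  shows "\<exists>\<phi>. lucky_colouring G \<phi>"
proof -
  interpret pair_graph G by fact
  let ?S = "{card (completion_edges G \<phi>) | \<phi>. chromatic_colouring G \<phi>}"
  have "completion_edges G \<phi> \<subseteq> Pow (pverts G)" for \<phi>
    unfolding completion_edges_def by blast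
  then have "card (completion_edges G \<phi>) \<le> card (Pow (pverts G))" for \<phi>
    by (intro card_mono) (simp_all add: pair_finite_verts)
  then have "finite ?S"
    by (intro finite_subset[of ?S "{..card (Pow (pverts G))}"] subsetI)
      (elim CollectE exE conjE, simp_all)
  moreover have "?S \<noteq> {}"
    using ex_chromatic_colouring[OF assms] by blast
  ultimately have "chromatic_completion_number G \<in> ?S"
    unfolding chromatic_completion_number_def by (rule Max_in)
  then show ?thesis
    unfolding lucky_colouring_def by (elim CollectE exE conjE) (metis (no_types))
qed

end

theory Submission
  imports Defs
begin

text \<open>
  Both sides of the equivalence compare Lucky colourings through one relation, having the same
  colour. The colour classes are the equivalence classes of this relation on the vertices, so two
  colourings have the same classes exactly when they identify the same pairs of vertices
  (\<open>colour_classes_eq_iff\<close>). The completion edges record the relation on the distinct non-adjacent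
  pairs, and these are the only pairs about which two proper colourings can disagree: the ends of
  an edge always get different colours (\<open>completion_edges_eq_iff\<close>). Hence any two proper
  colourings have the same colour classes exactly when they have the same completion edges, and
  this applies in particular to any two Lucky colourings.
\<close>

lemma lucky_colouring_imp_proper_colouring:
  "lucky_colouring G \<phi> \<Longrightarrow> proper_colouring G \<phi>"
  by (simp add: lucky_colouring_def chromatic_colouring_def)

lemma colour_classes_eq_iff:
  "colour_classes G \<phi> = colour_classes G \<psi> \<longleftrightarrow>
     (\<forall>u \<in> pverts G. \<forall>v \<in> pverts G. \<phi> u = \<phi> v \<longleftrightarrow> \<psi> u = \<psi> v)"
proof -
  define cls where "cls \<theta> u = {v \<in> pverts G. \<theta> v = \<theta> u}" for \<theta> :: "'a \<Rightarrow> nat" and u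
  have classes: "colour_classes G \<theta> = cls \<theta> ` pverts G" for \<theta>
    unfolding colour_classes_def cls_def by blast
  have same_class: "\<theta> u = \<theta> v \<longleftrightarrow> (\<exists>C \<in> colour_classes G \<theta>. u \<in> C \<and> v \<in> C)"
    if "u \<in> pverts G" "v \<in> pverts G" for \<theta> u v
    unfolding classes using that by (auto simp: cls_def)
  show ?thesis
  proof
    assume "colour_classes G \<phi> = colour_classes G \<psi>"
    then show "\<forall>u \<in> pverts G. \<forall>v \<in> pverts G. \<phi> u = \<phi> v \<longleftrightarrow> \<psi> u = \<psi> v"
      using same_class by simp
  next
    assume "\<forall>u \<in> pverts G. \<forall>v \<in> pverts G. \<phi> u = \<phi> v \<longleftrightarrow> \<psi> u = \<psi> v"
    then have "cls \<phi> u = cls \<psi> u" if "u \<in> pverts G" for u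
      using that by (auto simp: cls_def)
    then show "colour_classes G \<phi> = colour_classes G \<psi>"
      unfolding classes by (rule image_cong[OF refl])
  qed
qed

text \<open>
  The set of unordered pairs is defined through some ordering of each pair; as adjacency is
  symmetric, every ordering serves.
\<close>

lemma (in pair_graph) doubleton_in_completion_edges_iff:
  "{u, v} \<in> completion_edges G \<phi> \<longleftrightarrow>
     u \<in> pverts G \<and> v \<in> pverts G \<and> u \<noteq> v \<and> (u, v) \<notin> parcs G \<and> \<phi> u \<noteq> \<phi> v"
proof -
  have "(u, v) \<in> parcs G \<longleftrightarrow> (v, u) \<in> parcs G"
    using arcs_symmetric by auto
  then show ?thesis
    unfolding completion_edges_def by (auto simp: doubleton_eq_iff)
qed

lemma (in pair_graph) completion_edges_eq_iff:
  assumes "proper_colouring G \<phi>" and "proper_colouring G \<psi>"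
  shows "completion_edges G \<phi> = completion_edges G \<psi> \<longleftrightarrow>
     (\<forall>u \<in> pverts G. \<forall>v \<in> pverts G. \<phi> u = \<phi> v \<longleftrightarrow> \<psi> u = \<psi> v)"
proof
  assume same_edges: "completion_edges G \<phi> = completion_edges G \<psi>"
  show "\<forall>u \<in> pverts G. \<forall>v \<in> pverts G. \<phi> u = \<phi> v \<longleftrightarrow> \<psi> u = \<psi> v"
  proof (intro ballI)
    fix u v
    assume verts: "u \<in> pverts G" "v \<in> pverts G"
    consider "u = v" | "(u, v) \<in> parcs G" | "u \<noteq> v" "(u, v) \<notin> parcs G"
      by blast
    then show "\<phi> u = \<phi> v \<longleftrightarrow> \<psi> u = \<psi> v"
    proof cases
      case 1
      then show ?thesis by simp
    next
      case 2
      then show ?thesis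
        using assms by (auto simp: proper_colouring_def)
    next
      case 3
      then show ?thesis
        using verts same_edges doubleton_in_completion_edges_iff[of u v \<phi>]
          doubleton_in_completion_edges_iff[of u v \<psi>] by simp
    qed
  qed
next
  assume "\<forall>u \<in> pverts G. \<forall>v \<in> pverts G. \<phi> u = \<phi> v \<longleftrightarrow> \<psi> u = \<psi> v"
  then show "completion_edges G \<phi> = completion_edges G \<psi>"
    unfolding completion_edges_def by blast
qed

theorem theorem2p7:
  fixes G :: "'a pair_pre_digraph"
  assumes "pair_graph G"
    and "Digraph_Component.connected (with_proj G)"
    and "parcs G \<noteq> {}"
    and "chromatic_completion_number G > 0"
  shows "SCC G \<longleftrightarrow> unique_chromatic_completion_edge_set G"
proof -
  interpret pair_graph G by fact
  have "colour_classes G \<phi> = colour_classes G \<psi> \<longleftrightarrow> completion_edges G \<phi> = completion_edges G \<psi>"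
    if "lucky_colouring G \<phi>" "lucky_colouring G \<psi>" for \<phi> \<psi>
    using that[THEN lucky_colouring_imp_proper_colouring]
    by (simp add: colour_classes_eq_iff completion_edges_eq_iff)
  then show ?thesis
    unfolding SCC_def unique_chromatic_completion_edge_set_def by blast
qed

end
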